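(* Let $V$ be a finite-dimensional real vector space, let $\Lambda\subseteq V$ be a full $\mathbb{Z}$-lattice, and let $G$ be a finite group acting linearly on $V$ and mapping $\Lambda$ onto itself, so that $G\leq \mathrm{GL}(\Lambda)$. Let $z\in V$ be an element such that the orbit $Gz$ linearly spans $V$. Then the normalizer equivalence class of $z$ contains infinitely many translation equivalence classes if and only if $\mathbf{N}_{\mathrm{GL}(\Lambda)}(G)$ has infinite order.
   Context: A full $\mathbb{Z}$-lattice in $V$ is the $\mathbb{Z}$-span of an $\mathbb{R}$-basis of $V$. $\mathrm{GL}(\Lambda)$ is the group of invertible $\mathbb{Z}$-linear maps $\Lambda\to\Lambda$, viewed as a subgroup of $\mathrm{GL}(V)$; $G$ is regarded as a finite subgroup of $\mathrm{GL}(\Lambda)$. $\mathbf{N}_{\mathrm{GL}(\Lambda)}(G)=\{S\in \mathrm{GL}(\Lambda) : S^{-1}gS\in G \text{ for all } g\in G\}$. $\mathrm{Fix}_\Lambda(G)$ is the set of elements of $\Lambda$ fixed by all $g\in G$. Two points $z,w$ are normalizer equivalent if $w=Sz+b$ with $S\in \mathbf{N}_{\mathrm{GL}(\Lambda)}(G)$ and $b\in\mathrm{Fix}_\Lambda(G)$; they are translation equivalent if $w-z\in \mathrm{Fix}_\Lambda(G)$. Each normalizer equivalence class is a union of translation equivalence classes. *)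

theory Defs
  imports "HOL-Analysis.Analysis" "HOL-Algebra.Group"
begin

interpretation int_module: module "\<lambda>(n::int) (x::'v::real_vector). of_int n *\<^sub>R x"
  by unfold_locales (simp_all add: scaleR_add_right scaleR_add_left)

definition int_span :: "'v::real_vector set \<Rightarrow> 'v set"
  where "int_span B = module.span (\<lambda>(n::int) x. of_int n *\<^sub>R x) B"

definition full_lattice :: "'v::real_vector set \<Rightarrow> bool"
  where "full_lattice \<Lambda> \<longleftrightarrow> (\<exists>B. independent B \<and> span B = UNIV \<and> \<Lambda> = int_span B)"

text \<open>
  The automorphism group of \<open>\<Lambda>\<close> is realised inside the general linear group of the ambient
  space; \<open>bij_betw_GL_lattice_restrict\<close> below shows that, for a full lattice, restriction to
  \<open>\<Lambda>\<close> identifies its elements with the invertible \<open>\<int>\<close>-linear maps from \<open>\<Lambda>\<close> to \<open>\<Lambda>\<close>.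
\<close>

definition GL_lattice :: "'v::real_vector set \<Rightarrow> ('v \<Rightarrow> 'v) monoid"
  where "GL_lattice \<Lambda> =
    \<lparr>carrier = {S. linear S \<and> bij S \<and> S ` \<Lambda> = \<Lambda>}, mult = (\<circ>), one = id\<rparr>"

definition lattice_normalizer :: "'v::real_vector set \<Rightarrow> ('v \<Rightarrow> 'v) set \<Rightarrow> ('v \<Rightarrow> 'v) set"
  where "lattice_normalizer \<Lambda> G =
    {S \<in> carrier (GL_lattice \<Lambda>).
      \<forall>g\<in>G. inv\<^bsub>GL_lattice \<Lambda>\<^esub> S \<otimes>\<^bsub>GL_lattice \<Lambda>\<^esub> g \<otimes>\<^bsub>GL_lattice \<Lambda>\<^esub> S \<in> G}"

definition lattice_Fix :: "'v set \<Rightarrow> ('v \<Rightarrow> 'v) set \<Rightarrow> 'v set"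
  where "lattice_Fix \<Lambda> G = {x \<in> \<Lambda>. \<forall>g\<in>G. g x = x}"

definition normalizer_equivalence :: "'v::real_vector set \<Rightarrow> ('v \<Rightarrow> 'v) set \<Rightarrow> 'v rel"
  where "normalizer_equivalence \<Lambda> G =
    {(z, w). \<exists>S\<in>lattice_normalizer \<Lambda> G. \<exists>b\<in>lattice_Fix \<Lambda> G. w = S z + b}"

definition translation_equivalence :: "'v::real_vector set \<Rightarrow> ('v \<Rightarrow> 'v) set \<Rightarrow> 'v rel"
  where "translation_equivalence \<Lambda> G = {(z, w). w - z \<in> lattice_Fix \<Lambda> G}"

lemma group_GL_lattice: "group (GL_lattice \<Lambda>)"
proof (rule groupI)
  fix S assume S: "S \<in> carrier (GL_lattice \<Lambda>)"
  then have lin: "linear S" and b: "bij S" and im: "S ` \<Lambda> = \<Lambda>"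
    by (auto simp: GL_lattice_def)
  let ?T = "inv_into UNIV S"
  have "linear ?T"
  proof (rule linearI)
    have *: "S (?T x) = x" for x
      using b by (simp add: bij_is_surj surj_f_inv_f)
    have **: "x = ?T y" if "S x = y" for x y
      using b that by (auto simp: bij_is_inj inv_f_f)
    show "?T (x + y) = ?T x + ?T y" for x y
      by (rule **[symmetric]) (simp add: linear_add[OF lin] *)
    show "?T (c *\<^sub>R x) = c *\<^sub>R ?T x" for c x
      by (rule **[symmetric]) (simp add: linear_scale[OF lin] *)
  qed
  moreover have "bij ?T"
    using b by (rule bij_imp_bij_inv)
  moreover have "?T ` \<Lambda> = \<Lambda>"
    using image_inv_f_f[OF bij_is_inj[OF b], of \<Lambda>] im by simp
  moreover have "?T \<circ> S = id"
    using b by (simp add: bij_is_inj)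
  ultimately show "\<exists>T\<in>carrier (GL_lattice \<Lambda>). T \<otimes>\<^bsub>GL_lattice \<Lambda>\<^esub> S = \<one>\<^bsub>GL_lattice \<Lambda>\<^esub>"
    by (auto simp: GL_lattice_def)
next
  fix S T assume "S \<in> carrier (GL_lattice \<Lambda>)" "T \<in> carrier (GL_lattice \<Lambda>)"
  moreover from this have "(S \<circ> T) ` \<Lambda> = \<Lambda>"
    unfolding image_comp[symmetric] by (simp add: GL_lattice_def)
  ultimately show "S \<otimes>\<^bsub>GL_lattice \<Lambda>\<^esub> T \<in> carrier (GL_lattice \<Lambda>)"
    by (simp add: GL_lattice_def linear_compose bij_comp)
qed (simp_all add: GL_lattice_def comp_assoc linear_id)

lemma int_span_hom_eq_linear:
  fixes f g :: "'v::real_vector \<Rightarrow> 'w::real_vector"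
  assumes add: "\<And>x y. x \<in> int_span B \<Longrightarrow> y \<in> int_span B \<Longrightarrow> f (x + y) = f x + f y"
    and g: "linear g" and eq: "\<And>b. b \<in> B \<Longrightarrow> f b = g b" and x: "x \<in> int_span B"
  shows "f x = g x"
proof -
  have L: "0 \<in> int_span B" "\<And>x y. x \<in> int_span B \<Longrightarrow> y \<in> int_span B \<Longrightarrow> x + y \<in> int_span B"
    "\<And>n x. x \<in> int_span B \<Longrightarrow> of_int n *\<^sub>R x \<in> int_span B"
    unfolding int_span_def
    by (auto intro: int_module.span_zero int_module.span_add int_module.span_scale)
  have f0: "f 0 = 0"
    using add[of 0 0] L(1) by simp
  let ?P = "{x \<in> int_span B. f x = g x}"
  have nat: "of_nat n *\<^sub>R x \<in> ?P" if "x \<in> ?P" for n x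
    using that
    by (induction n)
      (auto simp: f0 linear_0[OF g] L add linear_add[OF g] scaleR_add_left)
  have neg: "- x \<in> ?P" if "x \<in> ?P" for x
  proof -
    have "- x \<in> int_span B"
      using L(3)[of x "-1"] that by simp
    moreover from this have "f x + f (- x) = 0"
      using add[of x "- x"] that f0 by simp
    ultimately show ?thesis
      using that by (simp add: linear_neg[OF g] add_eq_0_iff)
  qed
  have "int_module.subspace ?P"
  proof (rule int_module.subspaceI)
    show "0 \<in> ?P" using L f0 linear_0[OF g] by simp
    show "x + y \<in> ?P" if "x \<in> ?P" "y \<in> ?P" for x y
      using that L add linear_add[OF g] by simp
    show "of_int n *\<^sub>R x \<in> ?P" if "x \<in> ?P" for n x
    proof (cases n)
      case (nonneg m)
      then show ?thesis using nat[OF that, of m] by simp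
    next
      case (neg m)
      then show ?thesis
        using nat[OF \<open>\<And>x. x \<in> ?P \<Longrightarrow> - x \<in> ?P\<close>[OF that], of "Suc m"]
        by (simp add: scaleR_left_distrib scaleR_left_diff_distrib)
    qed
  qed
  moreover have "B \<subseteq> ?P"
    using eq int_module.span_superset[of B] by (auto simp: int_span_def)
  ultimately have "int_span B \<subseteq> ?P"
    unfolding int_span_def by (rule int_module.span_minimal[rotated])
  with x show ?thesis by auto
qed

lemma bij_betw_GL_lattice_restrict:
  assumes "full_lattice \<Lambda>"
  shows "bij_betw (\<lambda>S. restrict S \<Lambda>) (carrier (GL_lattice \<Lambda>))
    {f \<in> extensional \<Lambda>. bij_betw f \<Lambda> \<Lambda> \<and> (\<forall>x\<in>\<Lambda>. \<forall>y\<in>\<Lambda>. f (x + y) = f x + f y)}"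
    (is "bij_betw ?r ?C ?A")
proof -
  obtain B where B: "independent B" "span B = UNIV" and \<Lambda>: "\<Lambda> = int_span B"
    using assms by (auto simp: full_lattice_def)
  have BL: "B \<subseteq> \<Lambda>"
    unfolding \<Lambda> int_span_def by (rule int_module.span_superset)
  have addL: "x + y \<in> \<Lambda>" if "x \<in> \<Lambda>" "y \<in> \<Lambda>" for x y
    using that unfolding \<Lambda> int_span_def by (rule int_module.span_add)
  have eqI: "S = T" if "linear S" "linear T" "\<And>x. x \<in> B \<Longrightarrow> S x = T x" for S T :: "'a \<Rightarrow> 'a"
    using linear_eq_on[OF that(1,2)] that(3) B(2) by (metis UNIV_I ext)
  have ext: "\<exists>S. linear S \<and> (\<forall>x\<in>\<Lambda>. S x = f x)" if "f \<in> ?A" for f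
  proof -
    obtain S where S: "linear S" "\<forall>x\<in>B. S x = f x"
      using linear_independent_extend[OF B(1)] by blast
    have "f x = S x" if "x \<in> \<Lambda>" for x
      using int_span_hom_eq_linear[of B f S x] S that \<open>f \<in> ?A\<close> by (auto simp: \<Lambda>)
    with S show ?thesis by auto
  qed
  show ?thesis
  proof (rule bij_betw_imageI)
    show "inj_on ?r ?C"
    proof (rule inj_onI)
      fix S T assume ST: "S \<in> ?C" "T \<in> ?C" and eq: "?r S = ?r T"
      have "S x = T x" if "x \<in> B" for x
        using fun_cong[OF eq, of x] that BL by auto
      with ST show "S = T"
        by (intro eqI) (auto simp: GL_lattice_def)
    qed
    show "?r ` ?C = ?A"
    proof (intro equalityI subsetI)
      fix f assume "f \<in> ?r ` ?C"
      then obtain S where S: "linear S" "bij S" "S ` \<Lambda> = \<Lambda>" and f: "f = ?r S"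
        by (auto simp: GL_lattice_def)
      have "bij_betw S \<Lambda> \<Lambda>"
        using S by (auto simp: bij_betw_def intro: inj_on_subset)
      then show "f \<in> ?A"
        using S addL by (auto simp: f linear_add cong: bij_betw_cong)
    next
      fix f assume f: "f \<in> ?A"
      let ?h = "restrict (inv_into \<Lambda> f) \<Lambda>"
      have bf: "bij_betw f \<Lambda> \<Lambda>" and fadd: "\<And>x y. x \<in> \<Lambda> \<Longrightarrow> y \<in> \<Lambda> \<Longrightarrow> f (x + y) = f x + f y"
        using f by auto
      have bh: "bij_betw (inv_into \<Lambda> f) \<Lambda> \<Lambda>"
        using bf by (rule bij_betw_inv_into)
      have hadd: "inv_into \<Lambda> f (x + y) = inv_into \<Lambda> f x + inv_into \<Lambda> f y"
        if "x \<in> \<Lambda>" "y \<in> \<Lambda>" for x y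
      proof (rule inv_into_f_eq)
        show "inj_on f \<Lambda>" using bf by (rule bij_betw_imp_inj_on)
        have m: "inv_into \<Lambda> f x \<in> \<Lambda>" "inv_into \<Lambda> f y \<in> \<Lambda>"
          using bh that by (auto dest: bij_betwE)
        then show "inv_into \<Lambda> f x + inv_into \<Lambda> f y \<in> \<Lambda>" by (rule addL)
        show "f (inv_into \<Lambda> f x + inv_into \<Lambda> f y) = x + y"
          using m that bf by (simp add: fadd bij_betw_inv_into_right)
      qed
      have h: "?h \<in> ?A"
        using bh hadd addL by (auto cong: bij_betw_cong)
      obtain S where S: "linear S" "\<forall>x\<in>\<Lambda>. S x = f x" using ext[OF f] by blast
      obtain T where T: "linear T" "\<forall>x\<in>\<Lambda>. T x = ?h x" using ext[OF h] by blast
      have fL: "f x \<in> \<Lambda>" "?h x \<in> \<Lambda>" if "x \<in> \<Lambda>" for x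
        using bf bh that by (auto dest: bij_betwE)
      have "S \<circ> T = id"
      proof (rule eqI)
        fix x assume "x \<in> B"
        then have "x \<in> \<Lambda>" using BL by auto
        then show "(S \<circ> T) x = id x"
          using S T fL bf by (simp add: bij_betw_inv_into_right)
      qed (use S T in \<open>auto simp: linear_compose linear_id linear_id[unfolded id_def]\<close>)
      moreover have "T \<circ> S = id"
      proof (rule eqI)
        fix x assume "x \<in> B"
        then have "x \<in> \<Lambda>" using BL by auto
        then show "(T \<circ> S) x = id x"
          using S T fL bf by (simp add: bij_betw_inv_into_left)
      qed (use S T in \<open>auto simp: linear_compose linear_id linear_id[unfolded id_def]\<close>)
      ultimately have "bij S"
        by (rule o_bij[rotated])
      moreover have "S ` \<Lambda> = \<Lambda>"
        using S(2) bf by (simp add: bij_betw_def cong: image_cong)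
      moreover have "f = ?r S"
        using f S(2) by (auto simp: extensional_def restrict_def)
      ultimately show "f \<in> ?r ` ?C"
        using S(1) by (auto simp: GL_lattice_def)
    qed
  qed
qed

lemma equiv_translation_equivalence:
  assumes L: "full_lattice \<Lambda>" and G: "subgroup G (GL_lattice \<Lambda>)"
  shows "equiv UNIV (translation_equivalence \<Lambda> G)"
proof -
  obtain B where \<Lambda>: "\<Lambda> = int_span B"
    using L by (auto simp: full_lattice_def)
  have lin: "linear g" if "g \<in> G" for g
    using subgroup.subset[OF G] that by (auto simp: GL_lattice_def)
  let ?F = "lattice_Fix \<Lambda> G"
  have 0: "0 \<in> ?F"
    using lin by (auto simp: lattice_Fix_def \<Lambda> int_span_def int_module.span_zero linear_0)
  have a: "x + y \<in> ?F" if "x \<in> ?F" "y \<in> ?F" for x y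
    using lin that by (auto simp: lattice_Fix_def \<Lambda> int_span_def int_module.span_add linear_add)
  have m: "x - y \<in> ?F" if "x \<in> ?F" "y \<in> ?F" for x y
    using lin that by (auto simp: lattice_Fix_def \<Lambda> int_span_def int_module.span_diff linear_diff)
  show ?thesis
  proof (rule equivI)
    show "sym (translation_equivalence \<Lambda> G)"
      using m[OF 0] by (force simp: sym_def translation_equivalence_def)
    show "trans (translation_equivalence \<Lambda> G)"
      using a by (force simp: trans_def translation_equivalence_def)
  qed (use 0 in \<open>auto simp: refl_on_def translation_equivalence_def\<close>)
qed

end

theory Submission
  imports Defs
begin

text \<open>
  Translation classes inside the normalizer class of \<open>z\<close> are exactly the classes of the points
  \<open>S z\<close> with \<open>S\<close> in the normalizer, so a finite normalizer gives finitely many of them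
  (\<open>translation_classes_eq_image\<close>). For the converse, three data attached to \<open>S\<close> are shown to
  determine it, each ranging over a finite set: the automorphism of \<open>G\<close> induced by conjugation,
  the translation class of \<open>S z\<close>, and the vector \<open>S p\<close>, where \<open>p = (\<Sum>g\<in>G. g z)\<close>.

  If \<open>S\<close> and \<open>T\<close> induce the same automorphism and \<open>T z = S z + b\<close> with \<open>b\<close> fixed by \<open>G\<close>, then
  moving \<open>g\<close> through \<open>S\<close> and \<open>T\<close> gives \<open>T (h z) = S (h z) + b\<close> for all \<open>h \<in> G\<close>. Summing over
  \<open>h\<close>, \<open>T p = S p + card G b\<close>; so \<open>T p = S p\<close> forces \<open>b = 0\<close>, and \<open>T = S\<close> because the orbit of
  \<open>z\<close> spans.

  The real content is that \<open>S p\<close> takes at most the two values \<open>p\<close> and \<open>- p\<close>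
  (\<open>normalizer_orbit_sum\<close>). The operator \<open>\<Sum>g\<in>G. g\<close> commutes with \<open>S\<close>, and its range lies
  in the span of \<open>p\<close>, again because the orbit spans; hence \<open>S p = c p\<close>. If \<open>p\<close> is nonzero,
  its span contains a nonzero lattice vector, the image of a lattice basis
  vector under that operator. It is an
  eigenvector of \<open>S\<close> for \<open>c\<close>, and a lattice automorphism can neither shrink nor stretch a
  lattice vector along its own line (\<open>lattice_eigenvalue_abs_1\<close>).
\<close>

section \<open>Eigenvectors in a lattice\<close>

lemma int_span_representation_Ints:
  assumes B: "independent B" and x: "x \<in> int_span B"
  shows "representation B x b \<in> \<int>"
proof -
  let ?P = "{x \<in> span B. representation B x b \<in> \<int>}"
  have "int_module.subspace ?P"
    by (rule int_module.subspaceI)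
      (auto simp: representation_zero representation_add[OF B] representation_scale[OF B]
        span_zero span_add span_scale)
  moreover have "B \<subseteq> ?P"
    using B by (auto simp: representation_basis span_base)
  ultimately have "int_span B \<subseteq> ?P"
    unfolding int_span_def by (rule int_module.span_minimal[rotated])
  with x show ?thesis by auto
qed

text \<open>
  Otherwise the powers of \<open>T\<close> would push a nonzero integer coordinate of \<open>d\<close> to a nonzero
  integer of absolute value below \<open>1\<close>.
\<close>

lemma lattice_eigenvalue_abs_ge_1:
  fixes T :: "'v::real_vector \<Rightarrow> 'v"
  assumes L: "full_lattice \<Lambda>" and lin: "linear T" and im: "T ` \<Lambda> \<subseteq> \<Lambda>"
    and d: "d \<in> \<Lambda>" "d \<noteq> 0" and ev: "T d = c *\<^sub>R d" and c: "c \<noteq> 0"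
  shows "1 \<le> \<bar>c\<bar>"
proof (rule ccontr)
  assume "\<not> 1 \<le> \<bar>c\<bar>"
  then have lt: "\<bar>c\<bar> < 1" by simp
  obtain B where B: "independent B" "span B = UNIV" and \<Lambda>: "\<Lambda> = int_span B"
    using L by (auto simp: full_lattice_def)
  obtain b where b: "representation B d b \<noteq> 0"
  proof -
    have "(\<Sum>b | representation B d b \<noteq> 0. representation B d b *\<^sub>R b) = d"
      using sum_nonzero_representation_eq[OF B(1)] B(2) by auto
    with d(2) have "\<exists>b. representation B d b \<noteq> 0"
      by (metis (mono_tags, lifting) sum.neutral scaleR_zero_left)
    then show thesis using that by blast
  qed
  let ?r = "representation B d b"
  have pow: "(c ^ n) *\<^sub>R d \<in> \<Lambda>" for n
  proof (induction n)
    case (Suc n)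
    then have "T ((c ^ n) *\<^sub>R d) \<in> \<Lambda>" using im by auto
    then show ?case
      by (simp add: linear_scale[OF lin] ev mult.commute)
  qed (use d in simp)
  have int: "c ^ n * ?r \<in> \<int>" for n
    using int_span_representation_Ints[OF B(1), of "(c ^ n) *\<^sub>R d" b] pow[of n] B
    by (simp add: \<Lambda> representation_scale)
  have "(\<lambda>n. \<bar>c\<bar> ^ n * \<bar>?r\<bar>) \<longlonglongrightarrow> 0 * \<bar>?r\<bar>"
    using lt by (intro tendsto_mult LIMSEQ_power_zero) auto
  then have "\<forall>\<^sub>F n in sequentially. \<bar>c\<bar> ^ n * \<bar>?r\<bar> < 1"
    by (intro order_tendstoD(2)) auto
  then obtain n where "\<bar>c\<bar> ^ n * \<bar>?r\<bar> < 1"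
    by (auto simp: eventually_sequentially)
  then have "\<bar>c ^ n * ?r\<bar> < 1"
    by (simp add: abs_mult power_abs)
  then have "c ^ n * ?r = 0"
    using int[of n] Ints_nonzero_abs_ge1 by fastforce
  with c b show False by simp
qed

text \<open>The inverse of \<open>S\<close> preserves the lattice too, so the same bound holds for \<open>1 / c\<close>.\<close>

lemma lattice_eigenvalue_abs_1:
  fixes S :: "'v::real_vector \<Rightarrow> 'v"
  assumes L: "full_lattice \<Lambda>" and S: "S \<in> carrier (GL_lattice \<Lambda>)"
    and d: "d \<in> \<Lambda>" "d \<noteq> 0" and ev: "S d = c *\<^sub>R d"
  shows "\<bar>c\<bar> = 1"
proof -
  interpret GL: group "GL_lattice \<Lambda>" by (rule group_GL_lattice)
  let ?T = "inv\<^bsub>GL_lattice \<Lambda>\<^esub> S"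
  have T: "?T \<in> carrier (GL_lattice \<Lambda>)" using S by simp
  have "?T \<circ> S = id" using GL.l_inv[OF S] by (simp add: GL_lattice_def)
  from fun_cong[OF this, of d] have TSd: "?T (S d) = d" by simp
  have linS: "linear S" and imS: "S ` \<Lambda> \<subseteq> \<Lambda>" using S by (simp_all add: GL_lattice_def)
  have linT: "linear ?T" and imT: "?T ` \<Lambda> \<subseteq> \<Lambda>" using T by (simp_all add: GL_lattice_def)
  have cT: "c *\<^sub>R ?T d = d"
    using TSd by (simp only: ev linear_scale[OF linT])
  with d(2) have c: "c \<noteq> 0" by auto
  have "?T d = inverse c *\<^sub>R (c *\<^sub>R ?T d)" using c by simp
  then have evT: "?T d = inverse c *\<^sub>R d" by (simp only: cT)
  have "1 \<le> \<bar>c\<bar>"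
    by (rule lattice_eigenvalue_abs_ge_1[of \<Lambda> S d c, OF L linS imS d ev c])
  moreover have "1 \<le> \<bar>inverse c\<bar>"
    by (rule lattice_eigenvalue_abs_ge_1[of \<Lambda> ?T d "inverse c", OF L linT imT d evT])
      (simp add: c)
  then have "\<bar>c\<bar> \<le> 1"
    using c by (simp add: abs_inverse one_le_inverse_iff)
  ultimately show ?thesis by simp
qed

section \<open>The conjugation action of the normalizer\<close>

definition conj_by :: "'v::real_vector set \<Rightarrow> ('v \<Rightarrow> 'v) \<Rightarrow> ('v \<Rightarrow> 'v) \<Rightarrow> ('v \<Rightarrow> 'v)"
  where "conj_by \<Lambda> S g = inv\<^bsub>GL_lattice \<Lambda>\<^esub> S \<otimes>\<^bsub>GL_lattice \<Lambda>\<^esub> g \<otimes>\<^bsub>GL_lattice \<Lambda>\<^esub> S"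

lemma conj_by_intertwines:
  assumes S: "S \<in> carrier (GL_lattice \<Lambda>)"
  shows "S (conj_by \<Lambda> S g x) = g (S x)"
proof -
  interpret GL: group "GL_lattice \<Lambda>" by (rule group_GL_lattice)
  have "S \<circ> inv\<^bsub>GL_lattice \<Lambda>\<^esub> S = id"
    using GL.r_inv[OF S] by (simp add: GL_lattice_def)
  then have "S ((inv\<^bsub>GL_lattice \<Lambda>\<^esub> S) y) = y" for y by (metis comp_apply id_apply)
  then show ?thesis by (simp add: conj_by_def GL_lattice_def)
qed

text \<open>
  The normalizer is defined by an inclusion \<open>S\<^sup>-\<^sup>1 G S \<subseteq> G\<close>; finiteness of \<open>G\<close> turns it into
  equality.
\<close>

lemma bij_betw_conj_by:
  assumes G: "finite G" and S: "S \<in> lattice_normalizer \<Lambda> G"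
  shows "bij_betw (conj_by \<Lambda> S) G G"
proof -
  have SC: "S \<in> carrier (GL_lattice \<Lambda>)" and im: "conj_by \<Lambda> S ` G \<subseteq> G"
    using S by (auto simp: lattice_normalizer_def conj_by_def)
  have "inj_on (conj_by \<Lambda> S) G"
  proof (rule inj_onI)
    fix g h assume "conj_by \<Lambda> S g = conj_by \<Lambda> S h"
    then have "g (S x) = h (S x)" for x
      using conj_by_intertwines[OF SC] by metis
    moreover have "surj S" using SC by (simp add: GL_lattice_def bij_is_surj)
    ultimately show "g = h" by (metis ext surjD)
  qed
  with endo_inj_surj[OF G im] show ?thesis by (simp add: bij_betw_def)
qed

lemma orbit_sum_commutes:
  assumes G: "finite G" and S: "S \<in> lattice_normalizer \<Lambda> G"
  shows "(\<Sum>g\<in>G. g (S x)) = S (\<Sum>g\<in>G. g x)"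
proof -
  have SC: "S \<in> carrier (GL_lattice \<Lambda>)" using S by (simp add: lattice_normalizer_def)
  then have lin: "linear S" by (simp add: GL_lattice_def)
  have "(\<Sum>g\<in>G. g (S x)) = (\<Sum>g\<in>G. S (conj_by \<Lambda> S g x))"
    by (simp add: conj_by_intertwines[OF SC])
  also have "\<dots> = (\<Sum>h\<in>G. S (h x))"
    by (rule sum.reindex_bij_betw[OF bij_betw_conj_by[OF G S]])
  finally show ?thesis by (simp add: linear_sum[OF lin])
qed

section \<open>The orbit sum\<close>

text \<open>
  Summing over \<open>G\<close> gives the same vector at every point of the orbit, and the orbit spans.
\<close>

lemma orbit_sum_in_line:
  assumes G: "subgroup G (GL_lattice \<Lambda>)"
    and sp: "span {g z | g. g \<in> G} = UNIV"
  shows "(\<Sum>g\<in>G. g x) \<in> span {\<Sum>g\<in>G. g z}"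
proof -
  interpret GL: group "GL_lattice \<Lambda>" by (rule group_GL_lattice)
  have sub: "G \<subseteq> carrier (GL_lattice \<Lambda>)" by (rule subgroup.subset[OF G])
  have lin: "linear g" if "g \<in> G" for g using sub that by (auto simp: GL_lattice_def)
  have linsum: "linear (\<lambda>x. \<Sum>g\<in>G. g x)" by (rule linear_compose_sum) (use lin in blast)
  have orbit: "(\<Sum>g\<in>G. g (h z)) = (\<Sum>g\<in>G. g z)" if h: "h \<in> G" for h
  proof -
    have "bij_betw (\<lambda>g. g \<circ> h) G G"
    proof (rule bij_betw_byWitness[where f' = "\<lambda>g. g \<circ> inv\<^bsub>GL_lattice \<Lambda>\<^esub> h"])
      have hC: "h \<in> carrier (GL_lattice \<Lambda>)" using sub h by auto
      have e: "h \<circ> inv\<^bsub>GL_lattice \<Lambda>\<^esub> h = id" "inv\<^bsub>GL_lattice \<Lambda>\<^esub> h \<circ> h = id"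
        using GL.r_inv[OF hC] GL.l_inv[OF hC] by (simp_all add: GL_lattice_def)
      show "\<forall>g\<in>G. g \<circ> h \<circ> inv\<^bsub>GL_lattice \<Lambda>\<^esub> h = g" "\<forall>g\<in>G. g \<circ> inv\<^bsub>GL_lattice \<Lambda>\<^esub> h \<circ> h = g"
        by (simp_all add: comp_assoc e)
      show "(\<lambda>g. g \<circ> h) ` G \<subseteq> G" "(\<lambda>g. g \<circ> inv\<^bsub>GL_lattice \<Lambda>\<^esub> h) ` G \<subseteq> G"
        using subgroup.m_closed[OF G] subgroup.m_inv_closed[OF G] h
        by (auto simp: GL_lattice_def)
    qed
    from sum.reindex_bij_betw[OF this, of "\<lambda>g. g z"] show ?thesis by simp
  qed
  have "x \<in> span {g z | g. g \<in> G}" using sp by simp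
  then show ?thesis
  proof (induction rule: span_induct_alt)
    case base
    show ?case using linear_0[OF linsum] by (simp add: span_zero)
  next
    case (step a y w)
    then show ?case
      using linear_add[OF linsum, of "a *\<^sub>R y" w] linear_scale[OF linsum, of a y] orbit
      by (auto intro!: span_add span_scale intro: span_base)
  qed
qed

text \<open>
  This bounds the translations that can occur: elements of the normalizer act by a sign on the
  span of \<open>p\<close>, so only finitely many values of \<open>S p\<close> need to be told apart.
\<close>

lemma normalizer_orbit_sum:
  fixes \<Lambda> :: "'v::real_vector set"
  assumes L: "full_lattice \<Lambda>" and fin: "finite G" and G: "subgroup G (GL_lattice \<Lambda>)"
    and sp: "span {g z | g. g \<in> G} = UNIV" and S: "S \<in> lattice_normalizer \<Lambda> G"
    and p: "p = (\<Sum>g\<in>G. g z)"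
  shows "S p \<in> {p, - p}"
proof -
  have SC: "S \<in> carrier (GL_lattice \<Lambda>)" using S by (simp add: lattice_normalizer_def)
  then have linS: "linear S" by (simp add: GL_lattice_def)
  have GC: "linear g" "g ` \<Lambda> = \<Lambda>" if "g \<in> G" for g
    using subgroup.subset[OF G] that by (auto simp: GL_lattice_def)
  have linsum: "linear (\<lambda>x. \<Sum>g\<in>G. g x)" by (rule linear_compose_sum) (use GC in blast)
  note line = orbit_sum_in_line[OF G sp, folded p]
  have "S p \<in> span {p}"
    using line[of "S z"] orbit_sum_commutes[OF fin S, of z] by (simp add: p)
  then obtain c where c: "S p = c *\<^sub>R p" by (auto simp: span_singleton)
  show ?thesis
  proof (cases "p = 0")
    case True
    then show ?thesis using linear_0[OF linS] by simp
  next
    case False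
    obtain B where B: "independent B" "span B = UNIV" and \<Lambda>: "\<Lambda> = int_span B"
      using L by (auto simp: full_lattice_def)
    \<comment> \<open>If the operator vanished on a basis, it would vanish at \<open>z\<close>, where its value is \<open>p\<close>.\<close>
    obtain b where b: "b \<in> B" "(\<Sum>g\<in>G. g b) \<noteq> 0"
      using linear_eq_on[OF linsum linear_zero, of z B] B(2) False p by auto
    define d where "d = (\<Sum>g\<in>G. g b)"
    have "b \<in> \<Lambda>"
      using b int_module.span_superset[of B] by (auto simp: \<Lambda> int_span_def)
    then have "g b \<in> \<Lambda>" if "g \<in> G" for g using GC(2)[OF that] by auto
    then have "d \<in> \<Lambda>"
      unfolding d_def \<Lambda> int_span_def by (intro int_module.span_sum) auto
    moreover have "S d = c *\<^sub>R d"
      using line[of b] c by (auto simp: d_def span_singleton linear_scale[OF linS])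
    ultimately have "\<bar>c\<bar> = 1"
      using lattice_eigenvalue_abs_1[OF L SC] b(2) by (simp add: d_def)
    then have "c = 1 \<or> c = - 1" by linarith
    with c show ?thesis by auto
  qed
qed

section \<open>Translation classes and normalizer elements\<close>

lemma translation_classes_eq_image:
  assumes L: "full_lattice \<Lambda>" and G: "subgroup G (GL_lattice \<Lambda>)"
  shows "{C \<in> UNIV // translation_equivalence \<Lambda> G. C \<subseteq> normalizer_equivalence \<Lambda> G `` {z}} =
    (\<lambda>S. translation_equivalence \<Lambda> G `` {S z}) ` lattice_normalizer \<Lambda> G"
proof (intro equalityI subsetI)
  note eq = equiv_translation_equivalence[OF L G]
  fix C assume C: "C \<in> {C \<in> UNIV // translation_equivalence \<Lambda> G.
    C \<subseteq> normalizer_equivalence \<Lambda> G `` {z}}"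
  then obtain x where x: "C = translation_equivalence \<Lambda> G `` {x}" by (auto elim: quotientE)
  with equiv_class_self[OF eq] have "x \<in> C" by simp
  with C obtain S b where S: "S \<in> lattice_normalizer \<Lambda> G" "b \<in> lattice_Fix \<Lambda> G" "x = S z + b"
    by (auto simp: normalizer_equivalence_def)
  then have "(S z, x) \<in> translation_equivalence \<Lambda> G"
    by (simp add: translation_equivalence_def)
  with eq have "C = translation_equivalence \<Lambda> G `` {S z}"
    unfolding x by (metis equiv_class_eq)
  with S show "C \<in> (\<lambda>S. translation_equivalence \<Lambda> G `` {S z}) ` lattice_normalizer \<Lambda> G"
    by blast
next
  fix C assume "C \<in> (\<lambda>S. translation_equivalence \<Lambda> G `` {S z}) ` lattice_normalizer \<Lambda> G"
  then obtain S where S: "S \<in> lattice_normalizer \<Lambda> G"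
    and C: "C = translation_equivalence \<Lambda> G `` {S z}" by blast
  have "w \<in> normalizer_equivalence \<Lambda> G `` {z}" if "w \<in> C" for w
  proof -
    have "w - S z \<in> lattice_Fix \<Lambda> G" "w = S z + (w - S z)"
      using that by (auto simp: C translation_equivalence_def)
    with S show ?thesis unfolding normalizer_equivalence_def by blast
  qed
  then show "C \<in> {C \<in> UNIV // translation_equivalence \<Lambda> G.
    C \<subseteq> normalizer_equivalence \<Lambda> G `` {z}}"
    by (auto simp: C quotientI)
qed

text \<open>
  The last hypothesis is what excludes a nonzero translation: without it \<open>T\<close> and \<open>S\<close> could
  differ by a constant fixed vector on the whole orbit.
\<close>

lemma normalizer_element_eqI:
  fixes \<Lambda> :: "'v::real_vector set"
  assumes fin: "finite G" and G: "subgroup G (GL_lattice \<Lambda>)"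
    and sp: "span {g z | g. g \<in> G} = UNIV"
    and S: "S \<in> lattice_normalizer \<Lambda> G" and T: "T \<in> lattice_normalizer \<Lambda> G"
    and conj: "\<And>g. g \<in> G \<Longrightarrow> conj_by \<Lambda> S g = conj_by \<Lambda> T g"
    and b: "T z - S z \<in> lattice_Fix \<Lambda> G"
    and p: "S (\<Sum>g\<in>G. g z) = T (\<Sum>g\<in>G. g z)"
  shows "S = T"
proof -
  define b' where "b' = T z - S z"
  have SC: "S \<in> carrier (GL_lattice \<Lambda>)" and TC: "T \<in> carrier (GL_lattice \<Lambda>)"
    using S T by (simp_all add: lattice_normalizer_def)
  then have linS: "linear S" and linT: "linear T" by (simp_all add: GL_lattice_def)
  have *: "T (h z) = S (h z) + b'" if "h \<in> G" for h
  proof -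
    have "h \<in> conj_by \<Lambda> S ` G"
      using that by (simp only: bij_betw_imp_surj_on[OF bij_betw_conj_by[OF fin S]])
    then obtain g where g: "g \<in> G" "h = conj_by \<Lambda> S g" by (rule imageE)
    have "linear g" using subgroup.subset[OF G] g(1) by (auto simp: GL_lattice_def)
    then have "g (S z + b') = g (S z) + g b'" by (rule linear_add)
    moreover have "g b' = b'" using b g(1) unfolding b'_def lattice_Fix_def by blast
    moreover have "S z + b' = T z" by (simp add: b'_def)
    ultimately have "g (T z) = g (S z) + b'" by (simp only:)
    then show ?thesis
      unfolding g(2) conj_by_intertwines[OF SC]
      unfolding conj[OF g(1)] conj_by_intertwines[OF TC] .
  qed
  have "T (\<Sum>g\<in>G. g z) = (\<Sum>g\<in>G. S (g z) + b')"
    unfolding linear_sum[OF linT] by (rule sum.cong[OF refl *])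
  also have "\<dots> = S (\<Sum>g\<in>G. g z) + of_nat (card G) *\<^sub>R b'"
    unfolding linear_sum[OF linS] sum.distrib sum_constant_scaleR by (rule refl)
  finally have "of_nat (card G) *\<^sub>R b' = 0" using p by simp
  moreover have "card G \<noteq> 0"
    using fin subgroup.one_closed[OF G] by auto
  ultimately have "b' = 0" by simp
  have "S y = T y" if "y \<in> {g z | g. g \<in> G}" for y
  proof -
    from that obtain g where "g \<in> G" "y = g z" by blast
    with *[of g] \<open>b' = 0\<close> show ?thesis by simp
  qed
  then have "S x = T x" for x
    using linear_eq_on[OF linS linT, of x "{g z | g. g \<in> G}"] sp by blast
  then show ?thesis by (rule ext)
qed

theorem mainTheorem3:
  fixes \<Lambda> :: "'v::real_vector set" and G :: "('v \<Rightarrow> 'v) set" and z :: 'v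
  assumes "\<exists>B. finite_dimensional_vector_space ((*\<^sub>R) :: real \<Rightarrow> 'v \<Rightarrow> 'v) B"
    and "full_lattice \<Lambda>"
    and "finite G" and "subgroup G (GL_lattice \<Lambda>)"
    and "span {g z | g. g \<in> G} = UNIV"
  shows "infinite {C \<in> UNIV // translation_equivalence \<Lambda> G.
             C \<subseteq> normalizer_equivalence \<Lambda> G `` {z}}
         \<longleftrightarrow> infinite (lattice_normalizer \<Lambda> G)"
proof -
  note L = assms(2) and fin = assms(3) and G = assms(4) and sp = assms(5)
  let ?N = "lattice_normalizer \<Lambda> G"
  let ?cl = "\<lambda>S. translation_equivalence \<Lambda> G `` {S z}"
  define p where "p = (\<Sum>g\<in>G. g z)"
  let ?data = "\<lambda>S. (restrict (conj_by \<Lambda> S) G, ?cl S, S p)"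
  have "finite ?N" if cl: "finite (?cl ` ?N)"
  proof (rule inj_on_finite)
    show "inj_on ?data ?N"
    proof (rule inj_onI)
      fix S T assume ST: "S \<in> ?N" "T \<in> ?N" and eq: "?data S = ?data T"
      have "(S z, T z) \<in> translation_equivalence \<Lambda> G"
        using eq eq_equiv_class[OF _ equiv_translation_equivalence[OF L G]] by auto
      then have "T z - S z \<in> lattice_Fix \<Lambda> G"
        by (simp add: translation_equivalence_def)
      moreover have "conj_by \<Lambda> S g = conj_by \<Lambda> T g" if "g \<in> G" for g
      proof -
        have "restrict (conj_by \<Lambda> S) G = restrict (conj_by \<Lambda> T) G" using eq by simp
        from fun_cong[OF this, of g] that show ?thesis by simp
      qed
      ultimately show "S = T"
        using eq by (intro normalizer_element_eqI[OF fin G sp ST]) (simp_all add: p_def)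
    qed
    show "?data ` ?N \<subseteq> (G \<rightarrow>\<^sub>E G) \<times> (?cl ` ?N) \<times> {p, - p}"
    proof (rule image_subsetI)
      fix S assume S: "S \<in> ?N"
      have "restrict (conj_by \<Lambda> S) G \<in> G \<rightarrow>\<^sub>E G"
        using bij_betwE[OF bij_betw_conj_by[OF fin S]] by auto
      with S normalizer_orbit_sum[OF L fin G sp S p_def]
      show "?data S \<in> (G \<rightarrow>\<^sub>E G) \<times> (?cl ` ?N) \<times> {p, - p}" by blast
    qed
    show "finite ((G \<rightarrow>\<^sub>E G) \<times> (?cl ` ?N) \<times> {p, - p})"
      using fin cl by (intro finite_cartesian_product finite_PiE) auto
  qed
  then show ?thesis
    unfolding translation_classes_eq_image[OF L G] by blast
qed

end
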